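(* Consider any execution of a set of committed transactions under snapshot isolation. Every serialization anomaly, i.e. every cycle in the multiversion serialization history graph of the execution, contains a dangerous structure $$T_1 \xrightarrow{rw} T_2 \xrightarrow{rw} T_3$$ (two consecutive edges of the cycle, each of which is an rw-antidependency; $T_1$ and $T_3$ may be the same transaction) such that, if $T_1$ is read-only, then $T_3$ committed before $T_1$ took its snapshot.
   Context: **Snapshot isolation.** A (finite) set of committed transactions acts on a set of objects. Each transaction $T$ takes a snapshot at some time and commits at some later time. Snapshot and commit events of the transactions are totally ordered in time. Writes create new versions of objects. The versions of each object are totally ordered, starting with an initial version not written by any of the transactions, in the order in which the transactions writing them commit. - Reads: all reads of $T$ are performed against its snapshot. For each object it reads, $T$ sees the latest version written by a transaction that committed before $T$ took its snapshot (the initial version if there is none), apart from $T$'s own writes, which it may see. In particular, changes of another transaction $T'$ are visible to $T$ only if $T'$ committed before $T$ took its snapshot. - Writes: two concurrent transactions may not both write the same object. Two transactions are concurrent if each takes its snapshot before the other commits. Hence if two distinct transactions write the same object, one of them commits before the other takes its snapshot. The term "object" is abstract, so that dependencies caused by predicate reads are also covered. **Read-only.** A transaction is read-only if it performs no writes. **Multiversion serialization history graph.** This directed graph has one node per transaction. Between distinct transactions it has an edge from $A$ to $B$ (meaning that $A$ must precede $B$ in the apparent serial order) in each of the following cases: - wr-dependency $A \xrightarrow{wr} B$: $A$ writes a version of some object and $B$ reads that version. - ww-dependency $A \xrightarrow{ww} B$: $A$ writes a version of some object and $B$ replaces that version with the next version. - rw-antidependency $A \xrightarrow{rw} B$: $B$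 writes a version of some object and $A$ reads the immediately previous version of that object. **Serialization anomaly.** The execution has a serialization anomaly (it does not correspond to any serial order) when this graph contains a cycle. **Dangerous structure.** A dangerous structure is a pair of adjacent rw-antidependency edges $T_1 \xrightarrow{rw} T_2 \xrightarrow{rw} T_3$. *)

theory Defs
  imports Main "Graph_Theory.Graph_Theory"
begin

text \<open>
  A version of an object is either its initial version or is identified by the transaction
  that wrote it: each transaction contributes at most one version of each object, the one
  that it commits.
\<close>

datatype 't version = Initial | By 't

text \<open>
  \<^term>\<open>reads H A x v\<close> means that \<^term>\<open>A\<close> reads version \<^term>\<open>v\<close> of object \<^term>\<open>x\<close>.
  It is a relation, since a transaction may read an object both before and after writing it
  and then see two different versions of it.
\<close>

record ('t, 'x, 'time) history =
  transactions :: "'t set"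
  snapshot :: "'t \<Rightarrow> 'time"
  commit :: "'t \<Rightarrow> 'time"
  writes :: "'t \<Rightarrow> 'x set"
  reads :: "'t \<Rightarrow> 'x \<Rightarrow> 't version \<Rightarrow> bool"

definition versions :: "('t, 'x, 'time) history \<Rightarrow> 'x \<Rightarrow> 't version set" where
  "versions H x = insert Initial (By ` {A \<in> transactions H. x \<in> writes H A})"

fun version_less :: "('t, 'x, 'time::linorder) history \<Rightarrow> 't version \<Rightarrow> 't version \<Rightarrow> bool" where
  "version_less H Initial (By B) \<longleftrightarrow> True"
| "version_less H (By A) (By B) \<longleftrightarrow> commit H A < commit H B"
| "version_less H _ Initial \<longleftrightarrow> False"

definition next_version ::
    "('t, 'x, 'time::linorder) history \<Rightarrow> 'x \<Rightarrow> 't version \<Rightarrow> 't version \<Rightarrow> bool" where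
  "next_version H x v w \<longleftrightarrow>
     v \<in> versions H x \<and> w \<in> versions H x \<and> version_less H v w \<and>
     \<not> (\<exists>u \<in> versions H x. version_less H v u \<and> version_less H u w)"

fun in_snapshot :: "('t, 'x, 'time::linorder) history \<Rightarrow> 't \<Rightarrow> 't version \<Rightarrow> bool" where
  "in_snapshot H A Initial \<longleftrightarrow> True"
| "in_snapshot H A (By B) \<longleftrightarrow> commit H B < snapshot H A"

definition snapshot_version ::
    "('t, 'x, 'time::linorder) history \<Rightarrow> 't \<Rightarrow> 'x \<Rightarrow> 't version \<Rightarrow> bool" where
  "snapshot_version H A x v \<longleftrightarrow>
     v \<in> versions H x \<and> in_snapshot H A v \<and>
     \<not> (\<exists>u \<in> versions H x. in_snapshot H A u \<and> version_less H v u)"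

definition concurrent :: "('t, 'x, 'time::linorder) history \<Rightarrow> 't \<Rightarrow> 't \<Rightarrow> bool" where
  "concurrent H A B \<longleftrightarrow> snapshot H A < commit H B \<and> snapshot H B < commit H A"

locale si_execution =
  fixes H :: "('t, 'x, 'time::linorder) history"
  assumes finite_transactions: "finite (transactions H)"
    and snapshot_before_commit: "A \<in> transactions H \<Longrightarrow> snapshot H A < commit H A"
    and snapshots_distinct: "inj_on (snapshot H) (transactions H)"
    and commits_distinct: "inj_on (commit H) (transactions H)"
    and snapshot_neq_commit:
      "\<lbrakk>A \<in> transactions H; B \<in> transactions H\<rbrakk> \<Longrightarrow> snapshot H A \<noteq> commit H B"
    and snapshot_reads:
      "\<lbrakk>A \<in> transactions H; reads H A x v\<rbrakk> \<Longrightarrow>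
         snapshot_version H A x v \<or> (x \<in> writes H A \<and> v = By A)"
    and no_concurrent_writes:
      "\<lbrakk>A \<in> transactions H; B \<in> transactions H; A \<noteq> B; x \<in> writes H A; x \<in> writes H B\<rbrakk> \<Longrightarrow>
         \<not> concurrent H A B"

definition read_only :: "('t, 'x, 'time) history \<Rightarrow> 't \<Rightarrow> bool" where
  "read_only H A \<longleftrightarrow> writes H A = {}"

datatype dependency = WR | WW | RW

fun depends ::
    "('t, 'x, 'time::linorder) history \<Rightarrow> dependency \<Rightarrow> 't \<Rightarrow> 't \<Rightarrow> bool" where
  "depends H WR A B \<longleftrightarrow> (\<exists>x. x \<in> writes H A \<and> reads H B x (By A))"
| "depends H WW A B \<longleftrightarrow> (\<exists>x. next_version H x (By A) (By B))"
| "depends H RW A B \<longleftrightarrow> (\<exists>x v. next_version H x v (By B) \<and> reads H A x v)"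

text \<open>
  The arcs carry their kind, so two transactions may be joined by parallel arcs.
\<close>

definition serialization_graph ::
    "('t, 'x, 'time::linorder) history \<Rightarrow> ('t, 't \<times> dependency \<times> 't) pre_digraph" where
  "serialization_graph H =
     \<lparr>verts = transactions H,
      arcs = {(A, d, B). A \<in> transactions H \<and> B \<in> transactions H \<and> A \<noteq> B \<and> depends H d A B},
      tail = (\<lambda>(A, d, B). A),
      head = (\<lambda>(A, d, B). B)\<rparr>"

lemma loopfree_serialization_graph: "loopfree_digraph (serialization_graph H)"
  by unfold_locales (auto simp: serialization_graph_def)

text \<open>
  A cycle is a list of arcs starting at an arbitrary vertex, so its last arc is followed by
  its first. For a cycle of length two this yields the case \<^term>\<open>T1 = T3\<close>.
\<close>

definition consecutive_in :: "'e list \<Rightarrow> 'e \<Rightarrow> 'e \<Rightarrow> bool" where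
  "consecutive_in p e f \<longleftrightarrow> (\<exists>i < length p. p ! i = e \<and> p ! (Suc i mod length p) = f)"

definition dangerous_structure_in :: "('t \<times> dependency \<times> 't) list \<Rightarrow> 't \<Rightarrow> 't \<Rightarrow> 't \<Rightarrow> bool" where
  "dangerous_structure_in p T1 T2 T3 \<longleftrightarrow> consecutive_in p (T1, RW, T2) (T2, RW, T3)"

end

theory Submission
  imports Defs
begin

text \<open>
  Take \<open>T3\<close> to be the first transaction of the cycle to commit. A wr- or ww-dependency
  \<open>A \<rightarrow> B\<close> forces \<open>A\<close> to commit before \<open>B\<close> takes its snapshot, whereas an rw-antidependency
  \<open>A \<rightarrow> B\<close> forces \<open>A\<close> to take its snapshot before \<open>B\<close> commits. Hence the edge \<open>T2 \<rightarrow> T3\<close> of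
  the cycle can only be an rw-antidependency, so \<open>T2\<close> takes its snapshot before \<open>T3\<close> commits,
  and then the preceding edge \<open>T1 \<rightarrow> T2\<close> can only be an rw-antidependency as well. If \<open>T1\<close> is
  read-only, the edge \<open>T0 \<rightarrow> T1\<close> before it is a wr-dependency, so \<open>T1\<close> takes its snapshot
  after \<open>T0\<close> commits, which is no earlier than \<open>T3\<close> does.
\<close>

text \<open>Both sides list the vertices of the walk, once as start and heads, once as tails and
  end.\<close>

lemma (in pre_digraph) cas_imp_Cons_heads_eq_tails:
  "cas u p v \<Longrightarrow> u # map (head G) p = map (tail G) p @ [v]"
  by (induction u p v rule: cas.induct) auto

lemma (in pre_digraph) cycle_head_eq_tail_Suc:
  assumes "cycle p" "i < length p"
  shows "head G (p ! i) = tail G (p ! (Suc i mod length p))"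
proof -
  obtain u where "cas u p u"
    using assms(1) unfolding cycle_def awalk_def by blast
  then have eq: "u # map (head G) p = map (tail G) p @ [u]"
    using cas_imp_Cons_heads_eq_tails by blast
  have "head G (p ! i) = (map (tail G) p @ [u]) ! Suc i"
    using arg_cong[OF eq, of "\<lambda>xs. xs ! Suc i"] assms(2) by simp
  \<comment> \<open>For the wraparound: the last arc ends at \<open>u\<close>, and its successor has
    index 0.\<close>
  moreover have "tail G (p ! 0) = u"
    using arg_cong[OF eq, of hd] assms(2) by (cases p) auto
  ultimately show ?thesis
    using assms(2) by (cases "Suc i < length p") (auto simp: nth_append less_Suc_eq not_less_eq le_less_Suc_eq)
qed

lemma Suc_mod_surj:
  assumes "i < (n::nat)"
  obtains j where "j < n" "Suc j mod n = i"
proof (cases i)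
  case 0
  with assms that[of "n - 1"] show ?thesis by simp
next
  case (Suc j)
  with assms that[of j] show ?thesis by simp
qed

context si_execution
begin

text \<open>For \<open>WR\<close>, \<open>By A\<close> is not a write of \<open>B\<close>, so it
  comes from the snapshot of \<open>B\<close>. For \<open>WW\<close>, \<open>A\<close> takes its
  snapshot before \<open>B\<close> commits, so the ban on concurrent writers leaves only this
  order.\<close>

lemma depends_imp_commit_less_snapshot:
  assumes "A \<in> transactions H" "B \<in> transactions H" "A \<noteq> B" "depends H d A B" "d \<noteq> RW"
  shows "commit H A < snapshot H B"
proof (cases d)
  case WR
  then show ?thesis
    using assms snapshot_reads[of B] by (fastforce simp: snapshot_version_def)
next
  case WW
  then obtain x where x: "x \<in> writes H A" "x \<in> writes H B" "commit H A < commit H B"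
    using assms by (auto simp: next_version_def versions_def)
  moreover have "snapshot H A < commit H B"
    using snapshot_before_commit[of A] assms(1) x(3) by simp
  ultimately show ?thesis
    using no_concurrent_writes[of A B x] snapshot_neq_commit[of B A] assms
    by (auto simp: concurrent_def)
qed (use assms in simp)

text \<open>Otherwise \<open>By B\<close> would be in the snapshot of \<open>A\<close> and newer
  than the version read there. If \<open>A\<close> read its own write, \<open>B\<close> commits even
  after \<open>A\<close> does.\<close>

lemma antidepends_imp_snapshot_less_commit:
  assumes "A \<in> transactions H" "B \<in> transactions H" "depends H RW A B"
  shows "snapshot H A < commit H B"
proof -
  obtain x v where nv: "next_version H x v (By B)" and "reads H A x v"
    using assms(3) by auto
  with snapshot_reads[of A x v] assms(1) consider "snapshot_version H A x v" | "v = By A"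
    by blast
  then show ?thesis
  proof cases
    case 1
    then have "\<not> in_snapshot H A (By B)"
      using nv by (auto simp: snapshot_version_def next_version_def)
    then show ?thesis
      using snapshot_neq_commit[of A B] assms by auto
  next
    case 2
    then show ?thesis
      using nv snapshot_before_commit[of A] assms by (auto simp: next_version_def)
  qed
qed

text \<open>Edges of the other two kinds end at a writer.\<close>

lemma depends_on_read_only_imp_WR:
  assumes "depends H d A B" "read_only H B"
  shows "d = WR"
  using assms by (cases d) (auto simp: next_version_def versions_def read_only_def)

end

theorem theorem3:
  fixes H :: "('t, 'x, 'time::linorder) history"
    and p :: "('t \<times> dependency \<times> 't) list"
  assumes "si_execution H"
    and "pre_digraph.cycle (serialization_graph H) p"
  shows "\<exists>T1 T2 T3. dangerous_structure_in p T1 T2 T3 \<and>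
           (read_only H T1 \<longrightarrow> commit H T3 < snapshot H T1)"
proof -
  interpret si_execution H by fact
  interpret G: pre_digraph "serialization_graph H" .
  let ?c = "\<lambda>i. commit H (snd (snd (p ! i)))"
  have "p \<noteq> []" and arcs: "set p \<subseteq> arcs (serialization_graph H)"
    using assms(2) by (auto simp: G.cycle_def G.awalk_def)
  have arc: "A \<in> transactions H \<and> B \<in> transactions H \<and> A \<noteq> B \<and> depends H d A B"
    if "i < length p" "p ! i = (A, d, B)" for i A d B
    using subsetD[OF arcs nth_mem[OF that(1)]] that(2) by (simp add: serialization_graph_def)
  have pred: "\<exists>j A d. j < length p \<and> Suc j mod length p = i \<and> p ! j = (A, d, B)"
    if i: "i < length p" and p_i: "p ! i = (B, e, C)" for i B e C
  proof -
    obtain j where j: "j < length p" "Suc j mod length p = i"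
      using Suc_mod_surj[OF i] .
    moreover obtain A d B' where "p ! j = (A, d, B')"
      by (rule prod_cases3)
    ultimately show ?thesis
      using G.cycle_head_eq_tail_Suc[OF assms(2) j(1)] p_i
      by (auto simp: serialization_graph_def)
  qed
  obtain k where k: "k < length p" and min: "\<And>i. i < length p \<Longrightarrow> ?c k \<le> ?c i"
  proof -
    have "finite {..<length p}" "{..<length p} \<noteq> {}"
      using \<open>p \<noteq> []\<close> by (auto simp: lessThan_empty_iff)
    from ex_is_arg_min_if_finite[OF this, of ?c] show ?thesis
      using that by (auto simp: is_arg_min_linorder)
  qed
  obtain T2 d T3 where p_k: "p ! k = (T2, d, T3)"
    by (rule prod_cases3)
  obtain j T1 e where j: "j < length p" "Suc j mod length p = k" and p_j: "p ! j = (T1, e, T2)"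
    using pred[OF k p_k] by blast
  obtain i T0 f where i: "i < length p" and p_i: "p ! i = (T0, f, T1)"
    using pred[OF j(1) p_j] by blast
  \<comment> \<open>Minimality is stated for heads of arcs, so \<open>T0\<close> has to be exhibited
    as one. On short cycles these indices may coincide.\<close>
  obtain h S g where h: "h < length p" and p_h: "p ! h = (S, g, T0)"
    using pred[OF i p_i] by blast
  have T3_first: "commit H T3 \<le> commit H T0" "commit H T3 \<le> commit H T1"
      "commit H T3 \<le> commit H T2"
    using min[OF h] min[OF i] min[OF j(1)] p_h p_i p_j p_k by simp_all
  note arc_k = arc[OF k p_k] and arc_j = arc[OF j(1) p_j] and arc_i = arc[OF i p_i]
  have d: "d = RW"
    using depends_imp_commit_less_snapshot[of T2 T3 d] snapshot_before_commit[of T3]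
      arc_k T3_first by fastforce
  then have "snapshot H T2 < commit H T3"
    using antidepends_imp_snapshot_less_commit arc_k by blast
  then have e: "e = RW"
    using depends_imp_commit_less_snapshot[of T1 T2 e] arc_j T3_first by fastforce
  have "dangerous_structure_in p T1 T2 T3"
    using j p_j p_k d e by (auto simp: dangerous_structure_in_def consecutive_in_def)
  moreover have "commit H T3 < snapshot H T1" if "read_only H T1"
  proof -
    have "f = WR"
      using depends_on_read_only_imp_WR that arc_i by blast
    then show ?thesis
      using depends_imp_commit_less_snapshot[of T0 T1 f] arc_i T3_first by simp
  qed
  ultimately show ?thesis by blast
qed

end
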